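(* Let $K$ be a field and $R=K[[t_1,\ldots,t_m]]$. If $>$ is a $\underline{t}$-local monomial ordering on $\mathrm{Mon}^s(\underline{t},\underline{x})$, then every $R[\underline{x}]$-submodule of $R[\underline{x}]^s$ and every $R[\underline{x}]_>$-submodule of $R[\underline{x}]_>^s$ has a standard basis.
   Context: $R[\underline{x}]=K[[t_1,\ldots,t_m]][x_1,\ldots,x_n]$ is the polynomial ring in $\underline{x}=(x_1,\ldots,x_n)$ over the formal power series ring $R$ in $\underline{t}=(t_1,\ldots,t_m)$. $\mathrm{Mon}(\underline{t},\underline{x})=\{\underline{t}^\alpha\underline{x}^\beta\mid\alpha\in\mathbb{N}^m,\beta\in\mathbb{N}^n\}$ and $\mathrm{Mon}^s(\underline{t},\underline{x})=\{\underline{t}^\alpha\underline{x}^\beta e_i\mid \alpha\in\mathbb{N}^m,\beta\in\mathbb{N}^n,1\le i\le s\}$, with $e_i$ the $i$-th unit vector. A monomial ordering on $\mathrm{Mon}(\underline{t},\underline{x})$ is a total ordering compatible with multiplication. A monomial ordering on $\mathrm{Mon}^s(\underline{t},\underline{x})$ is a total ordering $>$ such that $p>p'$ implies $\underline{t}^\alpha\underline{x}^\beta p>\underline{t}^\alpha\underline{x}^\beta p'$ for all $\alpha,\beta$, and for which there is a monomial ordering on $\mathrm{Mon}(\underline{t},\underline{x})$ (the induced one, also denoted $>$) such that $\underline{t}^\alpha\underline{x}^\beta>\underline{t}^{\alpha'}\underline{x}^{\beta'}\Leftrightarrow\underline{t}^\alpha\underline{x}^\beta e_i>\underline{t}^{\alpha'}\underline{x}^{\beta'}e_i$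 for each $i$. It is $\underline{t}$-local if $t_i<1$ for all $i=1,\ldots,m$ in the induced ordering. For $0\ne f\in R[\underline{x}]^s$, $\mathrm{lm}_>(f)$ is the largest monomial occurring in $f$ with non-zero coefficient and $\mathrm{lt}_>(f)$ the corresponding term including its coefficient; $\mathrm{lm}_>(0)=0$. $S_>=\{u\in R[\underline{x}]\mid\mathrm{lt}_>(u)=1\}$ and $R[\underline{x}]_>=S_>^{-1}R[\underline{x}]$. For $f/u\in R[\underline{x}]_>^s$ with $u\in S_>$ set $\mathrm{lm}_>(f/u)=\mathrm{lm}_>(f)$ (well defined). For a subset $G$ of $R[\underline{x}]^s$ or $R[\underline{x}]_>^s$ let $L_>(G)=\langle\mathrm{lm}_>(g)\mid g\in G\rangle\leq K[\underline{t},\underline{x}]^s$ (a module over the polynomial ring $K[\underline{t},\underline{x}]$). A standard basis of a submodule $I$ of $R[\underline{x}]^s$ or of $R[\underline{x}]_>^s$ is a finite subset $G\subset I$ with $L_>(G)=L_>(I)$. *)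

theory Defs
  imports
    "HOL-Algebra.Module"
    "HOL-Library.FuncSet"
    "HOL-Library.Product_Plus"
    "HOL-Library.Poly_Mapping"
begin

section \<open>Multivariate formal power series\<close>

text \<open>
  The type \<open>'a mfps\<close> consists of the formal power series in the countably many variables
  \<open>t 0, t 1, \<dots>\<close>: an arbitrary coefficient for every exponent vector of finite support.
  The ring \<open>K[[t 0, \<dots>, t (m - 1)]]\<close> is carved out of it by the set \<open>mfps_carrier m\<close> below,
  so that \<open>m\<close> may be any natural number, including \<open>0\<close>.
\<close>

type_synonym expo = "nat \<Rightarrow>\<^sub>0 nat"

typedef 'a mfps = "UNIV :: (expo \<Rightarrow> 'a) set"
  morphisms mfps_coeff Abs_mfps
  by simp

lemma mfps_coeff_Abs [simp]: "mfps_coeff (Abs_mfps f) = f"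
  by (simp add: Abs_mfps_inverse)

lemma mfps_eq_iff: "f = g \<longleftrightarrow> (\<forall>\<gamma>. mfps_coeff f \<gamma> = mfps_coeff g \<gamma>)"
  by (metis ext mfps_coeff_inject)

definition expo_splits :: "expo \<Rightarrow> (expo \<times> expo) set" where
  "expo_splits \<gamma> = {(\<alpha>, \<beta>). \<alpha> + \<beta> = \<gamma>}"

lemma finite_expo_splits [simp]: "finite (expo_splits \<gamma>)"
proof -
  let ?B = "{f. \<forall>i. (i \<in> Poly_Mapping.keys \<gamma> \<longrightarrow> f i \<in> {..Max (range (Poly_Mapping.lookup \<gamma>))}) \<and> (i \<notin> Poly_Mapping.keys \<gamma> \<longrightarrow> f i = 0)}"
  have fin_range: "finite (range (Poly_Mapping.lookup \<gamma>))"
  proof (rule finite_subset)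
    show "range (Poly_Mapping.lookup \<gamma>) \<subseteq> insert 0 (Poly_Mapping.lookup \<gamma> ` Poly_Mapping.keys \<gamma>)"
      by (auto simp: in_keys_iff)
  qed simp
  have "finite ?B"
    by (rule finite_set_of_finite_funs) simp_all
  have le: "Poly_Mapping.lookup \<alpha> \<in> ?B" if "\<alpha> + \<beta> = \<gamma>" for \<alpha> \<beta> :: expo
  proof -
    have *: "Poly_Mapping.lookup \<alpha> i \<le> Poly_Mapping.lookup \<gamma> i" for i
      using that by (auto simp: lookup_add)
    show ?thesis
      using * fin_range by (auto simp: in_keys_iff intro: order.trans[OF * Max_ge]) (metis * le_zero_eq)
  qed
  have "finite (Poly_Mapping.lookup -` ?B)"
    by (rule finite_vimageI[OF \<open>finite ?B\<close>]) (simp add: inj_def poly_mapping_eqI)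
  moreover have "expo_splits \<gamma> \<subseteq> (Poly_Mapping.lookup -` ?B) \<times> (Poly_Mapping.lookup -` ?B)"
    using le by (fastforce simp: expo_splits_def add.commute)
  ultimately show ?thesis
    by (meson finite_SigmaI finite_subset)
qed

instantiation mfps :: (comm_ring_1) comm_ring_1
begin

definition "0 = Abs_mfps (\<lambda>_. 0)"
definition "1 = Abs_mfps (\<lambda>\<gamma>. if \<gamma> = 0 then 1 else 0)"
definition "f + g = Abs_mfps (\<lambda>\<gamma>. mfps_coeff f \<gamma> + mfps_coeff g \<gamma>)"
definition "f - g = Abs_mfps (\<lambda>\<gamma>. mfps_coeff f \<gamma> - mfps_coeff g \<gamma>)"
definition "- f = Abs_mfps (\<lambda>\<gamma>. - mfps_coeff f \<gamma>)"
definition "f * g =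
  Abs_mfps (\<lambda>\<gamma>. \<Sum>(\<alpha>, \<beta>)\<in>expo_splits \<gamma>. mfps_coeff f \<alpha> * mfps_coeff g \<beta>)"

instance
proof
  fix a b c :: "'a mfps"
  note defs = zero_mfps_def one_mfps_def plus_mfps_def minus_mfps_def uminus_mfps_def times_mfps_def
  show "a + b + c = a + (b + c)" "a + b = b + a" "0 + a = a" "- a + a = 0" "a - b = a + - b"
    by (simp_all add: mfps_eq_iff defs algebra_simps)
  show "a * b * c = a * (b * c)"
  proof (unfold mfps_eq_iff, intro allI)
    fix \<gamma>
    have "mfps_coeff (a * b * c) \<gamma> =
      (\<Sum>((\<sigma>, \<zeta>), (\<alpha>, \<beta>))\<in>(SIGMA p:expo_splits \<gamma>. expo_splits (fst p)).
         mfps_coeff a \<alpha> * mfps_coeff b \<beta> * mfps_coeff c \<zeta>)"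
      by (subst sum.Sigma[symmetric]) (simp_all add: defs sum_distrib_right case_prod_unfold)
    also have "\<dots> =
      (\<Sum>((\<alpha>, \<sigma>), (\<beta>, \<zeta>))\<in>(SIGMA p:expo_splits \<gamma>. expo_splits (snd p)).
         mfps_coeff a \<alpha> * mfps_coeff b \<beta> * mfps_coeff c \<zeta>)"
      by (rule sum.reindex_bij_witness
            [where i = "\<lambda>((\<alpha>, \<sigma>), (\<beta>, \<zeta>)). ((\<alpha> + \<beta>, \<zeta>), (\<alpha>, \<beta>))"
               and j = "\<lambda>((\<sigma>, \<zeta>), (\<alpha>, \<beta>)). ((\<alpha>, \<beta> + \<zeta>), (\<beta>, \<zeta>))"])
         (auto simp: expo_splits_def add.assoc)
    also have "\<dots> = mfps_coeff (a * (b * c)) \<gamma>"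
      by (subst sum.Sigma[symmetric]) (simp_all add: defs sum_distrib_left case_prod_unfold mult.assoc)
    finally show "mfps_coeff (a * b * c) \<gamma> = mfps_coeff (a * (b * c)) \<gamma>" .
  qed
  show "a * b = b * a"
    unfolding mfps_eq_iff defs mfps_coeff_Abs
    by (intro allI sum.reindex_bij_witness[where i = prod.swap and j = prod.swap])
       (auto simp: expo_splits_def add.commute mult.commute)
  show "1 * a = a"
  proof (unfold mfps_eq_iff, intro allI)
    fix \<gamma>
    have "mfps_coeff (1 * a) \<gamma> = (\<Sum>p\<in>expo_splits \<gamma>. if p = (0, \<gamma>) then mfps_coeff a \<gamma> else 0)"
      unfolding defs mfps_coeff_Abs by (rule sum.cong) (auto simp: expo_splits_def split: if_splits)
    also have "\<dots> = mfps_coeff a \<gamma>"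
      by (subst sum.delta[OF finite_expo_splits]) (simp add: expo_splits_def)
    finally show "mfps_coeff (1 * a) \<gamma> = mfps_coeff a \<gamma>" .
  qed
  show "(a + b) * c = a * c + b * c"
    by (simp add: mfps_eq_iff defs case_prod_unfold algebra_simps sum.distrib)
  show "(0 :: 'a mfps) \<noteq> 1"
    by (auto simp: mfps_eq_iff defs)
qed

end

definition mfps_carrier :: "nat \<Rightarrow> 'a::zero mfps set" where
  "mfps_carrier m = {r. \<forall>\<alpha>. mfps_coeff r \<alpha> \<noteq> 0 \<longrightarrow> Poly_Mapping.keys \<alpha> \<subseteq> {..<m}}"


section \<open>The rings \<open>R[x]\<close> and \<open>K[t, x]\<close>\<close>

text \<open>
  The monomial with exponents \<open>\<alpha>\<close> in the \<open>t\<close> and \<open>\<beta>\<close> in the \<open>x\<close> is the pair \<open>(\<alpha>, \<beta>)\<close>;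
  the product of monomials is the componentwise sum, and the monomial \<open>1\<close> is \<open>0\<close>.
\<close>

type_synonym mon = "expo \<times> expo"

definition Mon :: "nat \<Rightarrow> nat \<Rightarrow> mon set" where
  "Mon m n = {(\<alpha>, \<beta>). Poly_Mapping.keys \<alpha> \<subseteq> {..<m} \<and> Poly_Mapping.keys \<beta> \<subseteq> {..<n}}"

type_synonym 'a Rx = "expo \<Rightarrow>\<^sub>0 'a mfps"

definition Rx :: "nat \<Rightarrow> nat \<Rightarrow> 'a::field Rx ring" where
  "Rx m n = \<lparr>carrier = {f. Poly_Mapping.keys f \<subseteq> {\<beta>. Poly_Mapping.keys \<beta> \<subseteq> {..<n}} \<and> range (Poly_Mapping.lookup f) \<subseteq> mfps_carrier m},
             mult = (*), one = 1, zero = 0, add = (+)\<rparr>"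

type_synonym 'a Ktx = "mon \<Rightarrow>\<^sub>0 'a"

definition Ktx :: "nat \<Rightarrow> nat \<Rightarrow> 'a::field Ktx ring" where
  "Ktx m n = \<lparr>carrier = {p. Poly_Mapping.keys p \<subseteq> Mon m n}, mult = (*), one = 1, zero = 0, add = (+)\<rparr>"

fun coeff_tx :: "'a::field Rx \<Rightarrow> mon \<Rightarrow> 'a" where
  "coeff_tx f (\<alpha>, \<beta>) = mfps_coeff (Poly_Mapping.lookup f \<beta>) \<alpha>"


section \<open>Free modules, generated submodules, localisation\<close>

text \<open>The \<open>i\<close>-th coordinate has index \<open>i < s\<close>; \<open>mult\<close> and \<open>one\<close> of the record play no role.\<close>

definition free_module :: "('r, 'c) ring_scheme \<Rightarrow> nat \<Rightarrow> ('r, nat \<Rightarrow> 'r) module" where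
  "free_module R s =
     \<lparr>carrier = {..<s} \<rightarrow>\<^sub>E carrier R,
      mult = undefined, one = undefined,
      zero = (\<lambda>i\<in>{..<s}. \<zero>\<^bsub>R\<^esub>),
      add = (\<lambda>f g. \<lambda>i\<in>{..<s}. f i \<oplus>\<^bsub>R\<^esub> g i),
      smult = (\<lambda>r f. \<lambda>i\<in>{..<s}. r \<otimes>\<^bsub>R\<^esub> f i)\<rparr>"

definition gen_submodule ::
    "('r, 'c) ring_scheme \<Rightarrow> ('r, 'v, 'd) module_scheme \<Rightarrow> 'v set \<Rightarrow> 'v set" where
  "gen_submodule R M A = \<Inter>{N. submodule N R M \<and> A \<subseteq> N}"

definition frac_rel :: "('r, 'c) ring_scheme \<Rightarrow> 'r set \<Rightarrow> (('r \<times> 'r) \<times> ('r \<times> 'r)) set" where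
  "frac_rel R S = {((a, u), (b, v)). a \<in> carrier R \<and> u \<in> S \<and> b \<in> carrier R \<and> v \<in> S \<and>
     (\<exists>w\<in>S. w \<otimes>\<^bsub>R\<^esub> (v \<otimes>\<^bsub>R\<^esub> a) = w \<otimes>\<^bsub>R\<^esub> (u \<otimes>\<^bsub>R\<^esub> b))}"

definition frac :: "('r, 'c) ring_scheme \<Rightarrow> 'r set \<Rightarrow> 'r \<Rightarrow> 'r \<Rightarrow> ('r \<times> 'r) set" where
  "frac R S a u = frac_rel R S `` {(a, u)}"

definition localization :: "('r, 'c) ring_scheme \<Rightarrow> 'r set \<Rightarrow> ('r \<times> 'r) set ring" where
  "localization R S =
     \<lparr>carrier = (carrier R \<times> S) // frac_rel R S,
      mult = (\<lambda>X Y. \<Union>(a, u)\<in>X. \<Union>(b, v)\<in>Y. frac R S (a \<otimes>\<^bsub>R\<^esub> b) (u \<otimes>\<^bsub>R\<^esub> v)),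
      one = frac R S \<one>\<^bsub>R\<^esub> \<one>\<^bsub>R\<^esub>,
      zero = frac R S \<zero>\<^bsub>R\<^esub> \<one>\<^bsub>R\<^esub>,
      add = (\<lambda>X Y. \<Union>(a, u)\<in>X. \<Union>(b, v)\<in>Y.
               frac R S ((v \<otimes>\<^bsub>R\<^esub> a) \<oplus>\<^bsub>R\<^esub> (u \<otimes>\<^bsub>R\<^esub> b)) (u \<otimes>\<^bsub>R\<^esub> v))\<rparr>"


section \<open>Monomial orderings\<close>

text \<open>An ordering is given by its strict part: \<open>gt p q\<close> stands for \<open>p > q\<close>.\<close>

definition strict_total_on :: "'p set \<Rightarrow> ('p \<Rightarrow> 'p \<Rightarrow> bool) \<Rightarrow> bool" where
  "strict_total_on A gt \<longleftrightarrow> irreflp_on A gt \<and> transp_on A gt \<and> totalp_on A gt"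

definition monomial_ordering :: "nat \<Rightarrow> nat \<Rightarrow> (mon \<Rightarrow> mon \<Rightarrow> bool) \<Rightarrow> bool" where
  "monomial_ordering m n gt \<longleftrightarrow>
     strict_total_on (Mon m n) gt \<and>
     (\<forall>p\<in>Mon m n. \<forall>p'\<in>Mon m n. \<forall>q\<in>Mon m n. gt p p' \<longrightarrow> gt (q + p) (q + p'))"

text \<open>The module monomial \<open>p e\<^sub>i\<close> is the pair \<open>(p, i)\<close>.\<close>

type_synonym mmon = "mon \<times> nat"

definition Mons :: "nat \<Rightarrow> nat \<Rightarrow> nat \<Rightarrow> mmon set" where
  "Mons m n s = Mon m n \<times> {..<s}"

definition induced_ordering ::
    "nat \<Rightarrow> nat \<Rightarrow> nat \<Rightarrow> (mmon \<Rightarrow> mmon \<Rightarrow> bool) \<Rightarrow> (mon \<Rightarrow> mon \<Rightarrow> bool) \<Rightarrow> bool" where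
  "induced_ordering m n s gts gt \<longleftrightarrow>
     monomial_ordering m n gt \<and>
     (\<forall>i<s. \<forall>p\<in>Mon m n. \<forall>p'\<in>Mon m n. gt p p' \<longleftrightarrow> gts (p, i) (p', i))"

definition module_monomial_ordering ::
    "nat \<Rightarrow> nat \<Rightarrow> nat \<Rightarrow> (mmon \<Rightarrow> mmon \<Rightarrow> bool) \<Rightarrow> bool" where
  "module_monomial_ordering m n s gts \<longleftrightarrow>
     strict_total_on (Mons m n s) gts \<and>
     (\<forall>(p, i)\<in>Mons m n s. \<forall>(p', j)\<in>Mons m n s. \<forall>q\<in>Mon m n.
        gts (p, i) (p', j) \<longrightarrow> gts (q + p, i) (q + p', j)) \<and>
     (\<exists>gt. induced_ordering m n s gts gt)"

definition t_local :: "nat \<Rightarrow> (mon \<Rightarrow> mon \<Rightarrow> bool) \<Rightarrow> bool" where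
  "t_local m gt \<longleftrightarrow> (\<forall>i<m. gt 0 (Poly_Mapping.single i 1, 0))"


section \<open>Leading monomials and standard bases\<close>

definition largest :: "('p \<Rightarrow> 'p \<Rightarrow> bool) \<Rightarrow> 'p set \<Rightarrow> 'p" where
  "largest gt A = (THE p. p \<in> A \<and> (\<forall>q\<in>A. q \<noteq> p \<longrightarrow> gt p q))"

definition supp :: "'a::field Rx \<Rightarrow> mon set" where
  "supp f = {p. coeff_tx f p \<noteq> 0}"

definition lt :: "(mon \<Rightarrow> mon \<Rightarrow> bool) \<Rightarrow> 'a::field Rx \<Rightarrow> 'a Ktx" where
  "lt gt f = (if f = 0 then 0 else
     (let p = largest gt (supp f) in Poly_Mapping.single p (coeff_tx f p)))"

definition S_gt :: "nat \<Rightarrow> nat \<Rightarrow> (mon \<Rightarrow> mon \<Rightarrow> bool) \<Rightarrow> 'a::field Rx set" where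
  "S_gt m n gt = {u \<in> carrier (Rx m n). lt gt u = 1}"

definition Rx_loc :: "nat \<Rightarrow> nat \<Rightarrow> (mon \<Rightarrow> mon \<Rightarrow> bool) \<Rightarrow> ('a::field Rx \<times> 'a Rx) set ring" where
  "Rx_loc m n gt = localization (Rx m n) (S_gt m n gt)"

definition vsupp :: "nat \<Rightarrow> (nat \<Rightarrow> 'a::field Rx) \<Rightarrow> mmon set" where
  "vsupp s f = {(p, i). i < s \<and> coeff_tx (f i) p \<noteq> 0}"

definition unit_vec :: "nat \<Rightarrow> mmon \<Rightarrow> nat \<Rightarrow> 'a::field Ktx" where
  "unit_vec s = (\<lambda>(p, i). \<lambda>j\<in>{..<s}. if j = i then Poly_Mapping.single p 1 else 0)"

definition lm :: "nat \<Rightarrow> (mmon \<Rightarrow> mmon \<Rightarrow> bool) \<Rightarrow> (nat \<Rightarrow> 'a::field Rx) \<Rightarrow> (nat \<Rightarrow> 'a Ktx)" where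
  "lm s gts f = (if vsupp s f = {} then (\<lambda>j\<in>{..<s}. 0) else unit_vec s (largest gts (vsupp s f)))"

text \<open>
  A vector over \<open>S\<inverse>R[x]\<close> is \<open>f / u\<close> with \<open>f\<close> in \<open>R[x]\<^sup>s\<close> and a common denominator \<open>u \<in> S\<close>. Its leading
  monomial is \<open>lm f\<close>, which does not depend on the representation \<open>f / u\<close>.
\<close>

definition frac_vec ::
    "nat \<Rightarrow> nat \<Rightarrow> nat \<Rightarrow> (mon \<Rightarrow> mon \<Rightarrow> bool) \<Rightarrow> (nat \<Rightarrow> 'a::field Rx) \<Rightarrow> 'a Rx \<Rightarrow>
     (nat \<Rightarrow> ('a Rx \<times> 'a Rx) set)" where
  "frac_vec m n s gt f u = (\<lambda>i\<in>{..<s}. frac (Rx m n) (S_gt m n gt) (f i) u)"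

definition lm_loc ::
    "nat \<Rightarrow> nat \<Rightarrow> nat \<Rightarrow> (mmon \<Rightarrow> mmon \<Rightarrow> bool) \<Rightarrow> (mon \<Rightarrow> mon \<Rightarrow> bool) \<Rightarrow>
     (nat \<Rightarrow> ('a::field Rx \<times> 'a Rx) set) \<Rightarrow> (nat \<Rightarrow> 'a Ktx)" where
  "lm_loc m n s gts gt F = (THE p. \<exists>f u. f \<in> carrier (free_module (Rx m n) s) \<and>
     u \<in> S_gt m n gt \<and> F = frac_vec m n s gt f u \<and> p = lm s gts f)"

definition leading_module ::
    "nat \<Rightarrow> nat \<Rightarrow> nat \<Rightarrow> ('v \<Rightarrow> (nat \<Rightarrow> 'a::field Ktx)) \<Rightarrow> 'v set \<Rightarrow> (nat \<Rightarrow> 'a Ktx) set" where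
  "leading_module m n s LM G = gen_submodule (Ktx m n) (free_module (Ktx m n) s) (LM ` G)"

definition standard_basis ::
    "nat \<Rightarrow> nat \<Rightarrow> nat \<Rightarrow> ('v \<Rightarrow> (nat \<Rightarrow> 'a::field Ktx)) \<Rightarrow> 'v set \<Rightarrow> 'v set \<Rightarrow> bool" where
  "standard_basis m n s LM I G \<longleftrightarrow>
     finite G \<and> G \<subseteq> I \<and> leading_module m n s LM G = leading_module m n s LM I"

end

theory Submission
  imports Defs "HOL.Topological_Spaces"
begin

text \<open>
  The leading module of any set of vectors is generated by monomials, and by Dickson's lemma
  finitely many of these monomials divide all the others. Vectors having these finitely many
  leading monomials form a standard basis (\<open>standard_basis_exists\<close>). What remains is that
  leading monomials make sense.

  A vector over \<open>R[x]\<close> may have infinitely many monomials, but only finitely many pairs of an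
  \<open>x\<close>-part and a component occur in it. For each pair, Dickson's lemma in the variables \<open>t\<close>
  leaves finitely many minimal exponents, and since the ordering is \<open>t\<close>-local a monomial is
  larger than its proper multiples by monomials in \<open>t\<close>. So the largest element of a finite
  set is the leading monomial (\<open>vsupp_has_largest\<close>).

  Over the localisation, a vector is a fraction \<open>f / u\<close> with a common denominator \<open>u\<close>
  (\<open>common_denominator\<close>). Multiplication by an element of \<open>S\<close>, whose leading term is \<open>1\<close>,
  preserves the leading monomial (\<open>vsupp_mult_largest\<close>). Hence \<open>S\<close> is multiplicatively
  closed, equality of fractions is an equivalence relation, and two representations of one
  vector, whose numerators agree up to multiplication by elements of \<open>S\<close>, have the same
  leading monomial (\<open>lm_frac_vec_unique\<close>).
\<close>


section \<open>Dickson's lemma\<close>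

lemma nat_sequence_mono_subseq:
  fixes f :: "nat \<Rightarrow> nat"
  shows "\<exists>r :: nat \<Rightarrow> nat. strict_mono r \<and> mono (\<lambda>k. f (r k))"
proof -
  obtain r :: "nat \<Rightarrow> nat" where r: "strict_mono r" "monoseq (\<lambda>k. f (r k))"
    using seq_monosub by blast
  show ?thesis
  proof (cases "mono (\<lambda>k. f (r k))")
    case True
    show ?thesis by (rule exI[of _ r]) (rule conjI[OF r(1) True])
  next
    case False
    with r(2) have dec: "antimono (\<lambda>k. f (r k))"
      by (auto simp: monoseq_iff)
    \<comment> \<open>An antitone sequence of natural numbers is constant once it has reached its minimum.\<close>
    obtain k where k: "\<And>l. f (r k) \<le> f (r l)"
      using ex_has_least_nat[of "\<lambda>_. True" _ "\<lambda>k. f (r k)"] by auto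
    have "f (r (l + k)) = f (r k)" for l
      using antimonoD[OF dec, of k "l + k"] k[of "l + k"] by simp
    then have "mono (\<lambda>l. f (r (l + k)))"
      by (simp add: mono_def)
    with r(1) have "strict_mono (\<lambda>l. r (l + k)) \<and> mono (\<lambda>l. f (r (l + k)))"
      by (simp add: strict_mono_def)
    then show ?thesis by (rule exI[of _ "\<lambda>l. r (l + k)"])
  qed
qed

lemma simultaneous_mono_subseq:
  fixes C :: "('a \<Rightarrow> nat) set" and x :: "nat \<Rightarrow> 'a"
  assumes "finite C"
  shows "\<exists>r :: nat \<Rightarrow> nat. strict_mono r \<and> (\<forall>c\<in>C. mono (\<lambda>k. c (x (r k))))"
  using assms
proof (induction C rule: finite_induct)
  case empty
  show ?case by (rule exI[of _ "\<lambda>k. k"]) (simp add: strict_mono_def)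
next
  case (insert c C)
  then obtain r :: "nat \<Rightarrow> nat" where r: "strict_mono r" "\<And>c. c \<in> C \<Longrightarrow> mono (\<lambda>k. c (x (r k)))"
    by blast
  obtain r' :: "nat \<Rightarrow> nat" where r': "strict_mono r'" "mono (\<lambda>k. c (x (r (r' k))))"
    using nat_sequence_mono_subseq[of "\<lambda>k. c (x (r k))"] by blast
  have "strict_mono (\<lambda>k. r (r' k))"
    using r(1) r'(1) by (simp add: strict_mono_def)
  moreover have "mono (\<lambda>k. d (x (r (r' k))))" if "d \<in> C" for d
    using r(2)[OF that] strict_mono_mono[OF r'(1)] by (simp add: mono_def)
  ultimately have "strict_mono (\<lambda>k. r (r' k)) \<and> (\<forall>c\<in>insert c C. mono (\<lambda>k. c (x (r (r' k)))))"
    using r'(2) by auto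
  then show ?case by (rule exI[of _ "\<lambda>k. r (r' k)"])
qed

text \<open>
  Without a finite basis one could choose forever a further element of \<open>A\<close> above none of the
  previous ones, which is absurd along a subsequence on which every \<open>c \<in> C\<close> is monotone.
  The elements carry their coordinates through \<open>C\<close>, so that exponent vectors in several
  groups of variables and discrete labels are treated alike.
\<close>
lemma Dickson_finite_basis:
  fixes C :: "('a \<Rightarrow> nat) set" and A :: "'a set"
  assumes "finite C"
  shows "\<exists>B. finite B \<and> B \<subseteq> A \<and> (\<forall>a\<in>A. \<exists>b\<in>B. \<forall>c\<in>C. c b \<le> c a)"
proof (rule ccontr)
  assume no: "\<not> ?thesis"
  let ?P = "\<lambda>(f :: nat \<Rightarrow> 'a) k a. a \<in> A \<and> (\<forall>l<k. \<exists>c\<in>C. \<not> c (f l) \<le> c a)"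
  have "\<exists>f. \<forall>k. ?P f k (f k)"
  proof (rule dependent_wellorder_choice)
    fix k :: nat and f :: "nat \<Rightarrow> 'a"
    assume f: "\<And>l. l < k \<Longrightarrow> ?P f l (f l)"
    have "finite (f ` {..<k}) \<and> f ` {..<k} \<subseteq> A"
      using f by (intro conjI finite_imageI finite_lessThan image_subsetI) (simp only: lessThan_iff)
    then obtain a where "a \<in> A" "\<not> (\<exists>b\<in>f ` {..<k}. \<forall>c\<in>C. c b \<le> c a)"
      using no by meson
    then have "?P f k a" by (auto simp del: not_le)
    then show "\<exists>a. ?P f k a" by (rule exI)
  next
    fix a :: 'a and f g :: "nat \<Rightarrow> 'a" and k :: nat
    assume "\<And>l. l < k \<Longrightarrow> f l = g l"
    then show "?P f k a = ?P g k a" by simp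
  qed
  then obtain f where "\<forall>k. ?P f k (f k)" ..
  then have f: "\<exists>c\<in>C. \<not> c (f l) \<le> c (f k)" if "l < k" for l k
    using that by simp
  obtain r :: "nat \<Rightarrow> nat" where r: "strict_mono r" "\<And>c. c \<in> C \<Longrightarrow> mono (\<lambda>k. c (f (r k)))"
    using simultaneous_mono_subseq[OF assms] by blast
  have "r 0 < r 1"
    using r(1) by (simp add: strict_mono_def)
  then obtain c where "c \<in> C" "\<not> c (f (r 0)) \<le> c (f (r 1))"
    using f by blast
  with monoD[OF r(2), of c 0 1] show False by simp
qed

text \<open>
  Subtraction of exponents is truncated, so the difference is a quotient of monomials only
  when the pointwise inequality holds.
\<close>
lemma exponent_divides:
  fixes \<alpha> \<beta> :: expo
  assumes "Poly_Mapping.keys \<alpha> \<subseteq> {..<m}" "Poly_Mapping.keys \<beta> \<subseteq> {..<m}"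
    and "\<And>i. i < m \<Longrightarrow> Poly_Mapping.lookup \<beta> i \<le> Poly_Mapping.lookup \<alpha> i"
  shows "(\<alpha> - \<beta>) + \<beta> = \<alpha>" "Poly_Mapping.keys (\<alpha> - \<beta>) \<subseteq> {..<m}"
proof -
  have "Poly_Mapping.lookup \<beta> i \<le> Poly_Mapping.lookup \<alpha> i" for i
    using assms(2,3) by (metis in_keys_iff le0 lessThan_iff subsetD)
  then show "(\<alpha> - \<beta>) + \<beta> = \<alpha>"
    by (intro poly_mapping_eqI) (simp add: lookup_add lookup_minus)
  show "Poly_Mapping.keys (\<alpha> - \<beta>) \<subseteq> {..<m}"
  proof
    fix i assume "i \<in> Poly_Mapping.keys (\<alpha> - \<beta>)"
    then have "i \<in> Poly_Mapping.keys \<alpha>"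
      by (auto simp: in_keys_iff lookup_minus)
    then show "i \<in> {..<m}" using assms(1) by blast
  qed
qed

text \<open>
  The label \<open>h\<close> restricts division to monomials of equal label. The component, as label, gives
  Dickson's lemma for monomials of a free module; the component together with the \<open>x\<close>-part gives
  division by monomials in \<open>t\<close> alone. A label becomes a coordinate through the indicators of its
  finitely many values.
\<close>
lemma Mons_finite_basis:
  assumes "A \<subseteq> Mons m n s" "finite (h ` A)"
  shows "\<exists>B. finite B \<and> B \<subseteq> A \<and>
    (\<forall>P\<in>A. \<exists>Q\<in>B. h Q = h P \<and> (\<exists>q\<in>Mon m n. fst P = q + fst Q))"
proof -
  define C :: "(mmon \<Rightarrow> nat) set" where "C =
      (\<lambda>i P. Poly_Mapping.lookup (fst (fst P)) i) ` {..<m} \<union>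
      (\<lambda>i P. Poly_Mapping.lookup (snd (fst P)) i) ` {..<n} \<union>
      (\<lambda>l P. of_bool (h P = l)) ` (h ` A)"
  have "finite C"
    unfolding C_def using assms(2) by simp
  from Dickson_finite_basis[OF this, of A]
  obtain B where B: "finite B" "B \<subseteq> A" "\<forall>P\<in>A. \<exists>Q\<in>B. \<forall>c\<in>C. c Q \<le> c P"
    by (elim exE conjE)
  have "\<exists>Q\<in>B. h Q = h P \<and> (\<exists>q\<in>Mon m n. fst P = q + fst Q)" if P: "P \<in> A" for P
  proof -
    from bspec[OF B(3) P] obtain Q where QB: "Q \<in> B" and "\<forall>c\<in>C. c Q \<le> c P"
      by (elim bexE)
    then have le: "c Q \<le> c P" if "c \<in> C" for c
      using that by (elim bspec)
    obtain \<alpha> \<beta> i where P_eq: "P = ((\<alpha>, \<beta>), i)" by (metis surj_pair)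
    obtain \<alpha>' \<beta>' j where Q_eq: "Q = ((\<alpha>', \<beta>'), j)" by (metis surj_pair)
    have QA: "Q \<in> A" using B(2) QB by blast
    have keys: "Poly_Mapping.keys \<alpha> \<subseteq> {..<m}" "Poly_Mapping.keys \<alpha>' \<subseteq> {..<m}"
      "Poly_Mapping.keys \<beta> \<subseteq> {..<n}" "Poly_Mapping.keys \<beta>' \<subseteq> {..<n}"
      using subsetD[OF assms(1) P] subsetD[OF assms(1) QA]
      by (simp_all add: P_eq Q_eq Mons_def Mon_def)
    have "(\<lambda>P. of_bool (h P = h Q)) \<in> C"
      unfolding C_def by (rule UnI2) (rule imageI[OF imageI[OF QA]])
    from le[OF this] have "h Q = h P" by (auto simp: of_bool_def split: if_splits)
    moreover have "Poly_Mapping.lookup \<alpha>' k \<le> Poly_Mapping.lookup \<alpha> k" if "k < m" for k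
    proof -
      have "(\<lambda>P. Poly_Mapping.lookup (fst (fst P)) k) \<in> C"
        unfolding C_def using that by (intro UnI1 imageI) simp
      from le[OF this] show ?thesis by (simp add: P_eq Q_eq)
    qed
    note a = exponent_divides[OF keys(1,2) this]
    have "Poly_Mapping.lookup \<beta>' k \<le> Poly_Mapping.lookup \<beta> k" if "k < n" for k
    proof -
      have "(\<lambda>P. Poly_Mapping.lookup (snd (fst P)) k) \<in> C"
        unfolding C_def using that by (intro UnI1 UnI2[OF imageI]) simp
      from le[OF this] show ?thesis by (simp add: P_eq Q_eq)
    qed
    note b = exponent_divides[OF keys(3,4) this]
    have "(\<alpha> - \<alpha>', \<beta> - \<beta>') \<in> Mon m n"
      using a(2) b(2) by (simp add: Mon_def)
    moreover have "fst P = (\<alpha> - \<alpha>', \<beta> - \<beta>') + fst Q"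
      using a(1) b(1) by (simp add: P_eq Q_eq)
    ultimately show ?thesis using QB by blast
  qed
  with B(1,2) show ?thesis by blast
qed


section \<open>Standard bases from monomial leading data\<close>

lemma submodule_subset_carrier: "submodule N R M \<Longrightarrow> N \<subseteq> carrier M"
  using subgroup.subset[OF submodule.axioms(1)] by fastforce

lemma submodule_free_zero:
  assumes "submodule N R (free_module R s)"
  shows "(\<lambda>i\<in>{..<s}. \<zero>\<^bsub>R\<^esub>) \<in> N"
proof -
  interpret submodule N R "free_module R s" by (rule assms)
  show ?thesis using one_closed by (simp add: free_module_def)
qed

lemma smult_unit_vec:
  "Poly_Mapping.single q 1 \<odot>\<^bsub>free_module (Ktx m n) s\<^esub> unit_vec s (p, i) =
    (unit_vec s (q + p, i) :: nat \<Rightarrow> 'a::field Ktx)"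
  by (auto simp: free_module_def unit_vec_def Ktx_def mult_single)

text \<open>
  The same argument serves vectors over \<open>R[x]\<close> and over its localisation, so the leading
  monomial map and the type of vectors are left abstract. Leading monomials equal to zero
  contribute nothing to the generated submodule.
\<close>
lemma standard_basis_exists:
  fixes LM :: "'v \<Rightarrow> (nat \<Rightarrow> 'a::field Ktx)"
  assumes LM: "\<And>f. f \<in> I \<Longrightarrow>
    LM f = (\<lambda>j\<in>{..<s}. 0) \<or> (\<exists>P\<in>Mons m n s. LM f = unit_vec s P)"
  shows "\<exists>G. standard_basis m n s LM I G"
proof -
  let ?M = "free_module (Ktx m n :: 'a Ktx ring) s"
  define A where "A = {P \<in> Mons m n s. \<exists>f\<in>I. LM f = unit_vec s P}"
  have A: "A \<subseteq> Mons m n s" by (auto simp: A_def)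
  have "snd ` A \<subseteq> {..<s}" by (auto simp: A_def Mons_def)
  then have "finite (snd ` A)" by (rule finite_subset) simp
  from Mons_finite_basis[OF A this] obtain B where B: "finite B" "B \<subseteq> A"
    "\<And>P. P \<in> A \<Longrightarrow> \<exists>Q\<in>B. snd Q = snd P \<and> (\<exists>q\<in>Mon m n. fst P = q + fst Q)"
    by blast
  have "\<forall>P\<in>B. \<exists>f. f \<in> I \<and> LM f = unit_vec s P"
    using B(2) by (auto simp: A_def)
  then obtain F where F: "\<And>P. P \<in> B \<Longrightarrow> F P \<in> I \<and> LM (F P) = unit_vec s P"
    by metis
  \<comment> \<open>A generated submodule is an intersection, so both leading modules agree once every
    submodule that contains the chosen leading monomials contains all of them.\<close>
  have sub: "LM f \<in> N" if f: "f \<in> I" and N: "submodule N (Ktx m n) ?M" "LM ` F ` B \<subseteq> N" for f N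
    using LM[OF f]
  proof (elim disjE bexE)
    assume "LM f = (\<lambda>j\<in>{..<s}. 0)"
    with submodule_free_zero[OF N(1)] show "LM f \<in> N"
      by (simp add: Ktx_def)
  next
    fix P assume P: "P \<in> Mons m n s" "LM f = unit_vec s P"
    then have "P \<in> A" using f by (auto simp: A_def)
    then obtain Q q where Q: "Q \<in> B" "snd Q = snd P" "q \<in> Mon m n" "fst P = q + fst Q"
      using B(3) by blast
    have "unit_vec s Q \<in> N" using F[OF Q(1)] N(2) Q(1) by (metis image_eqI subsetD)
    moreover have "Poly_Mapping.single q 1 \<in> carrier (Ktx m n :: 'a Ktx ring)"
      using Q(3) by (simp add: Ktx_def)
    ultimately have "Poly_Mapping.single q 1 \<odot>\<^bsub>?M\<^esub> unit_vec s Q \<in> N"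
      using submodule.smult_closed[OF N(1)] by blast
    also have "Poly_Mapping.single q 1 \<odot>\<^bsub>?M\<^esub> unit_vec s Q = unit_vec s P"
      using smult_unit_vec[of m n s q "fst Q" "snd Q", where 'a = 'a] Q(2,4)
      by (metis prod.collapse)
    finally show "LM f \<in> N" using P(2) by simp
  qed
  have FI: "F ` B \<subseteq> I" using F by blast
  have "leading_module m n s LM (F ` B) = leading_module m n s LM I"
    unfolding leading_module_def gen_submodule_def using sub FI
    by (intro arg_cong[where f = Inter] Collect_cong) blast
  with B(1) FI have "standard_basis m n s LM I (F ` B)"
    by (simp add: standard_basis_def)
  then show ?thesis by blast
qed


section \<open>Coefficients of polynomials over power series\<close>

lemma lookup_mult_expo_splits:
  fixes f g :: "expo \<Rightarrow>\<^sub>0 'b::comm_ring_1"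
  shows "Poly_Mapping.lookup (f * g) \<beta> =
    (\<Sum>(b, c)\<in>expo_splits \<beta>. Poly_Mapping.lookup f b * Poly_Mapping.lookup g c)"
proof -
  have "Poly_Mapping.lookup (f * g) \<beta> =
      (\<Sum>(b, c). Poly_Mapping.lookup f b * Poly_Mapping.lookup g c when \<beta> = b + c)"
    by (simp add: times_poly_mapping.rep_eq prod_fun_unfold_prod)
  also have "\<dots> = (\<Sum>(b, c)\<in>expo_splits \<beta>.
      Poly_Mapping.lookup f b * Poly_Mapping.lookup g c when \<beta> = b + c)"
    by (rule Sum_any.expand_superset[OF finite_expo_splits]) (auto simp: expo_splits_def)
  also have "\<dots> = (\<Sum>(b, c)\<in>expo_splits \<beta>. Poly_Mapping.lookup f b * Poly_Mapping.lookup g c)"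
    by (rule sum.cong) (auto simp: expo_splits_def)
  finally show ?thesis .
qed

lemma mfps_coeff_sum: "mfps_coeff (sum F A) \<alpha> = (\<Sum>a\<in>A. mfps_coeff (F a) \<alpha>)"
  by (induction A rule: infinite_finite_induct) (auto simp: zero_mfps_def plus_mfps_def)

definition mon_splits :: "mon \<Rightarrow> (mon \<times> mon) set" where
  "mon_splits p = {(a, b). a + b = p}"

lemma finite_mon_splits: "finite (mon_splits p)"
proof -
  obtain \<alpha> \<beta> where p: "p = (\<alpha>, \<beta>)" by (metis surj_pair)
  have "mon_splits p \<subseteq> (\<lambda>((b, b'), (a, a')). ((a, b), (a', b'))) ` (expo_splits \<beta> \<times> expo_splits \<alpha>)"
    by (force simp: mon_splits_def expo_splits_def p)
  then show ?thesis
    by (rule finite_subset) (intro finite_imageI finite_cartesian_product finite_expo_splits)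
qed

text \<open>
  The two Cauchy products, over the \<open>x\<close>-exponents of the polynomial and over the
  \<open>t\<close>-exponents of its power series coefficients, merge into a single convolution over
  monomials in \<open>t\<close> and \<open>x\<close>.
\<close>
lemma coeff_tx_mult:
  "coeff_tx (f * g) p = (\<Sum>(a, b)\<in>mon_splits p. coeff_tx f a * coeff_tx g b)"
proof -
  obtain \<alpha> \<beta> where p: "p = (\<alpha>, \<beta>)" by (metis surj_pair)
  have "coeff_tx (f * g) p = (\<Sum>((b, b'), (a, a'))\<in>expo_splits \<beta> \<times> expo_splits \<alpha>.
      coeff_tx f (a, b) * coeff_tx g (a', b'))"
    by (simp add: p lookup_mult_expo_splits mfps_coeff_sum case_prod_unfold times_mfps_def
        sum.cartesian_product)
  also have "\<dots> = (\<Sum>(a, b)\<in>mon_splits p. coeff_tx f a * coeff_tx g b)"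
    by (rule sum.reindex_bij_witness
          [where i = "\<lambda>((a, b), (a', b')). ((b, b'), (a, a'))"
             and j = "\<lambda>((b, b'), (a, a')). ((a, b), (a', b'))"])
       (auto simp: mon_splits_def expo_splits_def p)
  finally show ?thesis .
qed

lemma coeff_tx_mult_nonzero:
  assumes "coeff_tx (f * g) p \<noteq> 0"
  obtains a b where "p = a + b" "coeff_tx f a \<noteq> 0" "coeff_tx g b \<noteq> 0"
proof -
  have "(\<Sum>x\<in>mon_splits p. coeff_tx f (fst x) * coeff_tx g (snd x)) \<noteq> 0"
    using assms by (simp add: coeff_tx_mult case_prod_unfold)
  then obtain x where "x \<in> mon_splits p" "coeff_tx f (fst x) * coeff_tx g (snd x) \<noteq> 0"
    by (rule sum.not_neutral_contains_not_neutral)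
  then show ?thesis using that[of "fst x" "snd x"] by (auto simp: mon_splits_def)
qed

lemma coeff_tx_eqI: "(\<And>p. coeff_tx f p = coeff_tx g p) \<Longrightarrow> f = g"
  by (rule poly_mapping_eqI) (metis coeff_tx.simps mfps_eq_iff)

lemma coeff_tx_zero [simp]: "coeff_tx 0 p = 0"
  by (cases p) (simp add: zero_mfps_def)

lemma coeff_tx_one: "coeff_tx 1 p = (if p = 0 then 1 else 0)"
  by (cases p) (auto simp: lookup_one when_def zero_mfps_def one_mfps_def zero_prod_def)

lemma Mon_add: "p \<in> Mon m n \<Longrightarrow> q \<in> Mon m n \<Longrightarrow> p + q \<in> Mon m n"
  using Poly_Mapping.keys_add[of "fst p" "fst q"] Poly_Mapping.keys_add[of "snd p" "snd q"]
  by (auto simp: Mon_def case_prod_unfold)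

lemma zero_in_Mon: "0 \<in> Mon m n"
  by (simp add: Mon_def zero_prod_def)

text \<open>
  In this form, closure of \<open>R[x]\<close> under products is closure of monomials under products.
\<close>
lemma carrier_Rx_iff: "f \<in> carrier (Rx m n) \<longleftrightarrow> supp f \<subseteq> Mon m n"
proof
  assume "f \<in> carrier (Rx m n)"
  then have f: "Poly_Mapping.keys f \<subseteq> {\<beta>. Poly_Mapping.keys \<beta> \<subseteq> {..<n}}"
    "range (Poly_Mapping.lookup f) \<subseteq> mfps_carrier m"
    by (auto simp: Rx_def)
  show "supp f \<subseteq> Mon m n"
  proof
    fix p assume p: "p \<in> supp f"
    obtain \<alpha> \<beta> where p_eq: "p = (\<alpha>, \<beta>)" by (metis surj_pair)
    have c: "mfps_coeff (Poly_Mapping.lookup f \<beta>) \<alpha> \<noteq> 0"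
      using p by (simp add: supp_def p_eq)
    then have "Poly_Mapping.lookup f \<beta> \<noteq> 0" by (auto simp: zero_mfps_def)
    then have "\<beta> \<in> Poly_Mapping.keys f" by (simp add: in_keys_iff)
    then have "Poly_Mapping.keys \<beta> \<subseteq> {..<n}" using f(1) by blast
    moreover have "Poly_Mapping.keys \<alpha> \<subseteq> {..<m}"
      using f(2) c by (fastforce simp: mfps_carrier_def)
    ultimately show "p \<in> Mon m n" by (simp add: Mon_def p_eq)
  qed
next
  assume sub: "supp f \<subseteq> Mon m n"
  have "(\<alpha>, \<beta>) \<in> Mon m n" if "mfps_coeff (Poly_Mapping.lookup f \<beta>) \<alpha> \<noteq> 0" for \<alpha> \<beta>
    using sub that by (auto simp: supp_def)
  then have *: "Poly_Mapping.keys \<alpha> \<subseteq> {..<m}" "Poly_Mapping.keys \<beta> \<subseteq> {..<n}"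
    if "mfps_coeff (Poly_Mapping.lookup f \<beta>) \<alpha> \<noteq> 0" for \<alpha> \<beta>
    using that by (auto simp: Mon_def)
  have "Poly_Mapping.keys \<beta> \<subseteq> {..<n}" if "\<beta> \<in> Poly_Mapping.keys f" for \<beta>
  proof -
    have "\<exists>\<alpha>. mfps_coeff (Poly_Mapping.lookup f \<beta>) \<alpha> \<noteq> 0"
      using that by (auto simp: in_keys_iff mfps_eq_iff zero_mfps_def)
    then show ?thesis using *(2) by blast
  qed
  moreover have "range (Poly_Mapping.lookup f) \<subseteq> mfps_carrier m"
    using *(1) by (auto simp: mfps_carrier_def)
  ultimately show "f \<in> carrier (Rx m n)" by (auto simp: Rx_def)
qed

lemma carrier_Rx_mult:
  assumes "f \<in> carrier (Rx m n)" "g \<in> carrier (Rx m n)"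
  shows "f * g \<in> carrier (Rx m n)"
  unfolding carrier_Rx_iff
proof
  fix p assume "p \<in> supp (f * g)"
  then obtain a b where "p = a + b" "coeff_tx f a \<noteq> 0" "coeff_tx g b \<noteq> 0"
    by (auto simp: supp_def elim: coeff_tx_mult_nonzero)
  then show "p \<in> Mon m n"
    using assms Mon_add[of a m n b] by (auto simp: carrier_Rx_iff supp_def)
qed

lemma vsupp_subset_Mons:
  assumes "f \<in> carrier (free_module (Rx m n) s)"
  shows "vsupp s f \<subseteq> Mons m n s"
proof
  fix P assume "P \<in> vsupp s f"
  then obtain p i where P: "P = (p, i)" "i < s" "p \<in> supp (f i)"
    by (auto simp: vsupp_def supp_def)
  have "f i \<in> carrier (Rx m n)" using assms P(2) by (auto simp: free_module_def)
  then show "P \<in> Mons m n s" using P by (auto simp: Mons_def carrier_Rx_iff)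
qed

text \<open>
  Although the support may be infinite, a polynomial in \<open>x\<close> has finitely many coefficients.
\<close>
lemma finite_vsupp_x_parts:
  "finite ((\<lambda>P. (snd (fst P), snd P)) ` vsupp s f)"
proof (rule finite_subset)
  show "(\<lambda>P. (snd (fst P), snd P)) ` vsupp s f \<subseteq> (\<Union>i<s. Poly_Mapping.keys (f i)) \<times> {..<s}"
  proof (rule image_subsetI)
    fix P assume "P \<in> vsupp s f"
    moreover obtain \<alpha> \<beta> i where P: "P = ((\<alpha>, \<beta>), i)" by (metis surj_pair)
    ultimately have "i < s" "mfps_coeff (Poly_Mapping.lookup (f i) \<beta>) \<alpha> \<noteq> 0"
      by (auto simp: vsupp_def)
    moreover from this(2) have "Poly_Mapping.lookup (f i) \<beta> \<noteq> 0" by (auto simp: zero_mfps_def)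
    ultimately show "(snd (fst P), snd P) \<in> (\<Union>i<s. Poly_Mapping.keys (f i)) \<times> {..<s}"
      by (auto simp: P in_keys_iff)
  qed
qed simp



section \<open>Largest elements\<close>

text \<open>
  Separates the existence of a largest element from its choice by a definite description.
\<close>
definition is_largest :: "('p \<Rightarrow> 'p \<Rightarrow> bool) \<Rightarrow> 'p set \<Rightarrow> 'p \<Rightarrow> bool" where
  "is_largest gt A P \<longleftrightarrow> P \<in> A \<and> (\<forall>Q\<in>A. Q \<noteq> P \<longrightarrow> gt P Q)"

lemma strict_total_on_trans:
  "strict_total_on X gt \<Longrightarrow> x \<in> X \<Longrightarrow> y \<in> X \<Longrightarrow> z \<in> X \<Longrightarrow> gt x y \<Longrightarrow> gt y z \<Longrightarrow> gt x z"
  unfolding strict_total_on_def by (meson transp_onD)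

lemma strict_total_on_irrefl: "strict_total_on X gt \<Longrightarrow> x \<in> X \<Longrightarrow> \<not> gt x x"
  unfolding strict_total_on_def by (meson irreflp_onD)

lemma largest_eq:
  assumes "strict_total_on X gt" "A \<subseteq> X" "is_largest gt A P"
  shows "largest gt A = P"
  unfolding largest_def
proof (rule the_equality)
  show "P \<in> A \<and> (\<forall>Q\<in>A. Q \<noteq> P \<longrightarrow> gt P Q)"
    using assms(3) by (simp add: is_largest_def)
  fix Q assume Q: "Q \<in> A \<and> (\<forall>P\<in>A. P \<noteq> Q \<longrightarrow> gt Q P)"
  show "Q = P"
  proof (rule ccontr)
    assume "Q \<noteq> P"
    then have "gt P Q" "gt Q P" using Q assms(3) by (auto simp: is_largest_def)
    moreover have "P \<in> X" "Q \<in> X" using Q assms(2,3) by (auto simp: is_largest_def)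
    ultimately show False
      using strict_total_on_trans[OF assms(1)] strict_total_on_irrefl[OF assms(1)] by blast
  qed
qed

lemma finite_has_largest:
  assumes "strict_total_on X gt" "finite B" "B \<noteq> {}" "B \<subseteq> X"
  shows "\<exists>P. is_largest gt B P"
  using assms(2-4)
proof (induction B rule: finite_ne_induct)
  case (singleton x)
  show ?case by (auto simp: is_largest_def)
next
  case (insert x B)
  then obtain P where P: "is_largest gt B P" by auto
  have X: "x \<in> X" "P \<in> X" "P \<noteq> x" and PB: "P \<in> B"
    using P insert by (auto simp: is_largest_def)
  then consider "gt P x" | "gt x P"
    using assms(1) by (auto simp: strict_total_on_def totalp_on_def)
  then show ?case
  proof cases
    case 1
    with P show ?thesis by (auto simp: is_largest_def)
  next
    case 2
    have "gt x Q" if "Q \<in> B" for Q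
    proof (cases "Q = P")
      case False
      with P that have "gt P Q" by (auto simp: is_largest_def)
      then show ?thesis
        using strict_total_on_trans[OF assms(1) X(1,2) _ 2] that insert.prems by blast
    qed (use 2 in simp)
    then show ?thesis by (auto simp: is_largest_def)
  qed
qed

lemma largest_of_dominating_subset:
  assumes "strict_total_on X gt" "A \<subseteq> X" "B \<subseteq> A" "is_largest gt B P"
    and "\<And>a. a \<in> A \<Longrightarrow> \<exists>b\<in>B. a = b \<or> gt b a"
  shows "is_largest gt A P"
  unfolding is_largest_def
proof (intro conjI ballI impI)
  show "P \<in> A" using assms(3,4) by (auto simp: is_largest_def)
  fix a assume a: "a \<in> A" "a \<noteq> P"
  then obtain b where b: "b \<in> B" "a = b \<or> gt b a" using assms(5) by blast
  have "b = P \<or> gt P b" using assms(4) b(1) by (auto simp: is_largest_def)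
  moreover have "a \<in> X" "b \<in> X" "P \<in> X"
    using a b(1) \<open>P \<in> A\<close> assms(2,3) by auto
  ultimately show "gt P a"
    using b(2) a(2) strict_total_on_trans[OF assms(1)] by blast
qed


section \<open>Leading monomials for a t-local ordering\<close>

locale t_local_module_ordering =
  fixes m n s :: nat and gts :: "mmon \<Rightarrow> mmon \<Rightarrow> bool" and gt :: "mon \<Rightarrow> mon \<Rightarrow> bool"
  assumes module_ordering: "module_monomial_ordering m n s gts"
    and induced: "induced_ordering m n s gts gt"
    and local: "t_local m gt"
begin

lemma gts_total: "strict_total_on (Mons m n s) gts"
  using module_ordering by (simp add: module_monomial_ordering_def)

lemma gt_ordering: "monomial_ordering m n gt"
  using induced by (simp add: induced_ordering_def)

lemma gt_total: "strict_total_on (Mon m n) gt"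
  using gt_ordering by (simp add: monomial_ordering_def)

lemma gt_add:
  "gt p p' \<Longrightarrow> p \<in> Mon m n \<Longrightarrow> p' \<in> Mon m n \<Longrightarrow> q \<in> Mon m n \<Longrightarrow> gt (q + p) (q + p')"
  using gt_ordering by (simp add: monomial_ordering_def)

lemma gts_iff_gt:
  "p \<in> Mon m n \<Longrightarrow> p' \<in> Mon m n \<Longrightarrow> i < s \<Longrightarrow> gts (p, i) (p', i) \<longleftrightarrow> gt p p'"
  using induced by (simp add: induced_ordering_def)

lemma gts_mult_less_one:
  assumes "gt 0 q" "q \<in> Mon m n" "p \<in> Mon m n" "i < s"
  shows "gts (p, i) (q + p, i)"
  using gt_add[OF assms(1) zero_in_Mon assms(2,3)] assms Mon_add[of q m n p]
  by (simp add: gts_iff_gt add.commute)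

text \<open>
  Locality speaks of single variables; splitting off one variable at a time extends it to all
  monomials in \<open>t\<close>.
\<close>
lemma t_monomial_less_one:
  "Poly_Mapping.keys \<gamma> \<subseteq> {..<m} \<Longrightarrow> \<gamma> = 0 \<or> gt 0 (\<gamma>, 0)"
proof (induction "\<Sum>i<m. Poly_Mapping.lookup \<gamma> i" arbitrary: \<gamma> rule: less_induct)
  case less
  show ?case
  proof (cases "\<gamma> = 0")
    case False
    then obtain i where i: "i \<in> Poly_Mapping.keys \<gamma>" by (metis all_not_in_conv keys_eq_empty)
    with less.prems have im: "i < m" by blast
    let ?e = "Poly_Mapping.single i 1 :: expo"
    have le: "Poly_Mapping.lookup ?e k \<le> Poly_Mapping.lookup \<gamma> k" for k
      using i by (auto simp: lookup_single when_def in_keys_iff)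
    have keys_e: "Poly_Mapping.keys ?e \<subseteq> {..<m}" using im by simp
    note d = exponent_divides[OF less.prems keys_e le]
    have "(\<Sum>k<m. Poly_Mapping.lookup (\<gamma> - ?e) k) < (\<Sum>k<m. Poly_Mapping.lookup \<gamma> k)"
    proof (rule sum_strict_mono_ex1)
      show "\<exists>k\<in>{..<m}. Poly_Mapping.lookup (\<gamma> - ?e) k < Poly_Mapping.lookup \<gamma> k"
        using im i by (intro bexI[of _ i]) (auto simp: lookup_minus in_keys_iff)
    qed (auto simp: lookup_minus)
    from less.hyps[OF this d(2)]
    have IH: "\<gamma> - ?e = 0 \<or> gt 0 (\<gamma> - ?e, 0)" .
    have e: "gt 0 (?e, 0)" using local im by (simp add: t_local_def)
    have Mon_e: "(?e, 0) \<in> Mon m n" using keys_e by (simp add: Mon_def)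
    have Mon_d: "(\<gamma> - ?e, 0) \<in> Mon m n" using d(2) by (simp add: Mon_def)
    have sum: "(\<gamma>, 0) = (?e, 0) + (\<gamma> - ?e, 0 :: expo)" using d(1) by (simp add: add.commute)
    from IH have "gt 0 (\<gamma>, 0)"
    proof
      assume "\<gamma> - ?e = 0"
      with sum have "(\<gamma>, 0 :: expo) = (?e, 0)" by simp
      with e show ?thesis by simp
    next
      assume "gt 0 (\<gamma> - ?e, 0)"
      from gt_add[OF this zero_in_Mon Mon_d Mon_e] have "gt (?e, 0) (\<gamma>, 0)"
        by (simp only: sum add_0_right)
      moreover have "(\<gamma>, 0) \<in> Mon m n" using less.prems by (simp add: Mon_def)
      ultimately show ?thesis
        using strict_total_on_trans[OF gt_total zero_in_Mon Mon_e _ e] by blast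
    qed
    then show ?thesis ..
  qed simp
qed

text \<open>
  Each monomial of the support is a multiple, by a monomial in \<open>t\<close> alone, of one from a finite
  set \<open>B\<close> of monomials of the support. Such a multiple is never larger, so the largest element
  of \<open>B\<close> is the largest of all.
\<close>
lemma vsupp_has_largest:
  assumes "f \<in> carrier (free_module (Rx m n) s)" "vsupp s f \<noteq> {}"
  shows "\<exists>P. is_largest gts (vsupp s f) P"
proof -
  note sub = vsupp_subset_Mons[OF assms(1)]
  obtain B where B: "finite B" "B \<subseteq> vsupp s f"
    "\<And>P. P \<in> vsupp s f \<Longrightarrow> \<exists>Q\<in>B. (snd (fst Q), snd Q) = (snd (fst P), snd P) \<and>
       (\<exists>q\<in>Mon m n. fst P = q + fst Q)"
    using Mons_finite_basis[OF sub finite_vsupp_x_parts] by blast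
  have dom: "\<exists>Q\<in>B. P = Q \<or> gts Q P" if P: "P \<in> vsupp s f" for P
  proof -
    obtain Q q where Q: "Q \<in> B" "snd (fst Q) = snd (fst P)" "snd Q = snd P"
      "q \<in> Mon m n" "fst P = q + fst Q"
      using B(3)[OF P] by auto
    have Q_Mons: "fst Q \<in> Mon m n" "snd Q < s"
      using Q(1) B(2) sub by (auto simp: Mons_def)
    have q: "q = (fst q, 0)"
      using Q(2,5) by (cases q) (simp add: plus_prod_def)
    have "Poly_Mapping.keys (fst q) \<subseteq> {..<m}"
      using Q(4) by (auto simp: Mon_def)
    from t_monomial_less_one[OF this] have "q = 0 \<or> gt 0 q"
      using q by (metis zero_prod_def)
    then have "P = Q \<or> gts Q P"
    proof
      assume "q = 0"
      with Q(3,5) show ?thesis by (simp add: prod_eq_iff)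
    next
      assume "gt 0 q"
      from gts_mult_less_one[OF this Q(4) Q_Mons] show ?thesis
        using Q(3,5) by (metis prod.collapse)
    qed
    with Q(1) show ?thesis by blast
  qed
  then have "B \<noteq> {}" using assms(2) by blast
  then obtain P where "is_largest gts B P"
    using finite_has_largest[OF gts_total B(1)] B(2) sub by blast
  then show ?thesis
    using largest_of_dominating_subset[OF gts_total sub B(2) _ dom] by blast
qed

lemma lm_eq:
  assumes "f \<in> carrier (free_module (Rx m n) s)" "is_largest gts (vsupp s f) P"
  shows "lm s gts f = unit_vec s P"
  using largest_eq[OF gts_total vsupp_subset_Mons[OF assms(1)] assms(2)] assms(2)
  by (auto simp: lm_def is_largest_def)

lemma lm_zero_or_monomial:
  assumes "f \<in> carrier (free_module (Rx m n) s)"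
  shows "lm s gts f = (\<lambda>j\<in>{..<s}. 0) \<or> (\<exists>P\<in>Mons m n s. lm s gts f = unit_vec s P)"
proof (cases "vsupp s f = {}")
  case True
  then show ?thesis by (simp add: lm_def)
next
  case False
  then obtain P where P: "is_largest gts (vsupp s f) P"
    using vsupp_has_largest[OF assms] by blast
  then have "P \<in> Mons m n s"
    using vsupp_subset_Mons[OF assms] by (auto simp: is_largest_def)
  then show ?thesis using lm_eq[OF assms P] by blast
qed

text \<open>
  The product of \<open>1\<close> with the leading monomial \<open>P\<close> of \<open>f\<close> cannot cancel: any other way to
  obtain \<open>P\<close> as \<open>a b\<close> has \<open>a < 1\<close>, and \<open>b > P\<close> would be a monomial of \<open>f\<close>. The same comparison
  shows that every monomial of the product is at most \<open>P\<close>. The statement on coefficients is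
  what makes \<open>S\<close> closed under products: a product must have leading coefficient \<open>1\<close> too.
\<close>
lemma vsupp_mult_largest:
  assumes u: "supp u \<subseteq> Mon m n" "coeff_tx u 0 = 1" "\<And>q. q \<in> supp u \<Longrightarrow> q \<noteq> 0 \<Longrightarrow> gt 0 q"
    and f: "f \<in> carrier (free_module (Rx m n) s)" "is_largest gts (vsupp s f) P"
    and g: "\<And>i. i < s \<Longrightarrow> g i = u * f i"
  shows "is_largest gts (vsupp s g) P \<and>
    coeff_tx (g (snd P)) (fst P) = coeff_tx (f (snd P)) (fst P)"
proof -
  note sub = vsupp_subset_Mons[OF f(1)]
  obtain p i where P: "P = (p, i)" by (cases P)
  have Pf: "(p, i) \<in> vsupp s f" "(p, i) \<in> Mons m n s"
    using f(2) sub by (auto simp: is_largest_def P)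
  have below: "gts (b, j) (a + b, j)" if "a \<in> supp u" "a \<noteq> 0" "(b, j) \<in> vsupp s f" for a b j
    using gts_mult_less_one[OF u(3)[OF that(1,2)]] that u(1) sub by (force simp: Mons_def)
  have only: "coeff_tx u (fst x) * coeff_tx (f i) (snd x) = 0"
    if x: "x \<in> mon_splits p - {(0, p)}" for x
  proof (rule ccontr)
    assume nz: "\<not> ?thesis"
    obtain a b where ab: "x = (a, b)" by (cases x)
    have p: "p = a + b" "a \<noteq> 0" using x by (auto simp: ab mon_splits_def)
    have b: "(b, i) \<in> vsupp s f" and a: "a \<in> supp u"
      using nz Pf by (auto simp: ab vsupp_def supp_def)
    have lt: "gts (b, i) (p, i)" using below[OF a p(2) b] p(1) by simp
    moreover have "b \<noteq> p" using p by auto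
    then have "gts (p, i) (b, i)" using f(2) b by (auto simp: is_largest_def P)
    moreover have "(b, i) \<in> Mons m n s" using b sub by blast
    ultimately show False
      using strict_total_on_trans[OF gts_total] strict_total_on_irrefl[OF gts_total] Pf(2) by blast
  qed
  have "coeff_tx (u * f i) p = (\<Sum>x\<in>mon_splits p. coeff_tx u (fst x) * coeff_tx (f i) (snd x))"
    by (simp add: coeff_tx_mult case_prod_unfold)
  also have "\<dots> = (\<Sum>x\<in>{(0, p)}. coeff_tx u (fst x) * coeff_tx (f i) (snd x))"
    by (rule sum.mono_neutral_right) (use finite_mon_splits only in \<open>auto simp: mon_splits_def\<close>)
  also have "\<dots> = coeff_tx (f i) p" using u(2) by simp
  finally have coeff: "coeff_tx (u * f i) p = coeff_tx (f i) p" .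
  then have "P \<in> vsupp s g" using Pf(1) by (auto simp: vsupp_def P g)
  moreover have "gts P Q" if Q: "Q \<in> vsupp s g" "Q \<noteq> P" for Q
  proof -
    obtain q j where Q_eq: "Q = (q, j)" by (cases Q)
    have j: "j < s" and "coeff_tx (u * f j) q \<noteq> 0" using Q(1) by (auto simp: vsupp_def Q_eq g)
    from this(2) obtain a b where ab: "q = a + b" "coeff_tx u a \<noteq> 0" "coeff_tx (f j) b \<noteq> 0"
      by (rule coeff_tx_mult_nonzero)
    have a: "a \<in> supp u" and b: "(b, j) \<in> vsupp s f"
      using ab j by (auto simp: supp_def vsupp_def)
    have Mons: "(b, j) \<in> Mons m n s" "Q \<in> Mons m n s"
      using b a u(1) sub Mon_add[of a m n b] by (auto simp: Q_eq ab(1) Mons_def)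
    have "(b, j) = P \<or> gts P (b, j)" using f(2) b by (auto simp: is_largest_def)
    moreover have "(b, j) = Q \<or> gts (b, j) Q"
      using below[OF a _ b] by (cases "a = 0") (auto simp: Q_eq ab(1))
    ultimately show ?thesis
      using Q(2) strict_total_on_trans[OF gts_total _ Mons] Pf(2) P by blast
  qed
  ultimately show ?thesis
    using coeff Pf(1) by (simp add: is_largest_def P g vsupp_def)
qed

end

text \<open>
  A monomial ordering is a module ordering in rank one, so that facts about leading
  monomials of vectors also apply to the elements of the ring.
\<close>
lemma (in t_local_module_ordering) rank_one:
  "t_local_module_ordering m n 1 (\<lambda>P Q. gt (fst P) (fst Q)) gt"
proof
  have "induced_ordering m n 1 (\<lambda>P Q. gt (fst P) (fst Q)) gt"
    using gt_ordering by (simp add: induced_ordering_def)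
  moreover have "strict_total_on (Mons m n 1) (\<lambda>P Q. gt (fst P) (fst Q))"
    unfolding strict_total_on_def
  proof (intro conjI irreflp_onI transp_onI totalp_onI)
    fix P Q R assume "P \<in> Mons m n 1" "Q \<in> Mons m n 1" "R \<in> Mons m n 1"
      and "gt (fst P) (fst Q)" "gt (fst Q) (fst R)"
    then show "gt (fst P) (fst R)"
      using strict_total_on_trans[OF gt_total, of "fst P" "fst Q" "fst R"]
      by (auto simp: Mons_def)
  next
    fix P assume "P \<in> Mons m n 1"
    then show "\<not> gt (fst P) (fst P)"
      using strict_total_on_irrefl[OF gt_total, of "fst P"] by (auto simp: Mons_def)
  next
    fix P Q assume "P \<in> Mons m n 1" "Q \<in> Mons m n 1" "P \<noteq> Q"
    then have "fst P \<in> Mon m n" "fst Q \<in> Mon m n" "fst P \<noteq> fst Q"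
      by (auto simp: Mons_def)
    then show "gt (fst P) (fst Q) \<or> gt (fst Q) (fst P)"
      using gt_total by (simp add: strict_total_on_def totalp_on_def)
  qed
  moreover have "gt (fst (q + p, i)) (fst (q + p', j))"
    if "(p, i) \<in> Mons m n 1" "(p', j) \<in> Mons m n 1" "q \<in> Mon m n" "gt (fst (p, i)) (fst (p', j))"
    for p p' q and i j :: nat
    using that gt_add by (simp add: Mons_def)
  ultimately show "module_monomial_ordering m n 1 (\<lambda>P Q. gt (fst P) (fst Q))"
    unfolding module_monomial_ordering_def by blast
  show "induced_ordering m n 1 (\<lambda>P Q. gt (fst P) (fst Q)) gt" by fact
qed (rule local)

context t_local_module_ordering
begin

lemma rank_one_carrier:
  "f \<in> carrier (Rx m n) \<Longrightarrow> (\<lambda>i\<in>{..<1}. f) \<in> carrier (free_module (Rx m n) 1)"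
  by (simp add: free_module_def)

lemma rank_one_largest_iff:
  "is_largest (\<lambda>P Q. gt (fst P) (fst Q)) (vsupp 1 (\<lambda>i\<in>{..<1}. f)) (p, 0) \<longleftrightarrow>
    is_largest gt (supp f) p"
  by (auto simp: is_largest_def vsupp_def supp_def)

lemma supp_has_largest:
  assumes "f \<in> carrier (Rx m n)" "f \<noteq> 0"
  shows "\<exists>p. is_largest gt (supp f) p"
proof -
  interpret rank_one: t_local_module_ordering m n 1 "\<lambda>P Q. gt (fst P) (fst Q)" gt
    by (rule rank_one)
  have "\<exists>p. coeff_tx f p \<noteq> 0" using assms(2) coeff_tx_eqI[of f 0] by (metis coeff_tx_zero)
  then have "supp f \<noteq> {}" by (simp add: supp_def)
  then have "vsupp 1 (\<lambda>i\<in>{..<1}. f) \<noteq> {}" by (auto simp: vsupp_def supp_def)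
  then obtain P where P: "is_largest (\<lambda>P Q. gt (fst P) (fst Q)) (vsupp 1 (\<lambda>i\<in>{..<1}. f)) P"
    using rank_one.vsupp_has_largest[OF rank_one_carrier[OF assms(1)]] by blast
  then have "P = (fst P, 0)" by (auto simp: is_largest_def vsupp_def)
  with P have "is_largest gt (supp f) (fst P)"
    using rank_one_largest_iff by metis
  then show ?thesis ..
qed

lemma S_gt_iff:
  "u \<in> S_gt m n gt \<longleftrightarrow>
    u \<in> carrier (Rx m n) \<and> is_largest gt (supp u) 0 \<and> coeff_tx u 0 = 1"
proof (intro iffI)
  assume "u \<in> S_gt m n gt"
  then have u: "u \<in> carrier (Rx m n)" "lt gt u = 1" by (auto simp: S_gt_def)
  then have "u \<noteq> 0" by (auto simp: lt_def)
  then obtain p where p: "is_largest gt (supp u) p" using supp_has_largest[OF u(1)] by blast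
  have "largest gt (supp u) = p"
    using largest_eq[OF gt_total _ p] u(1) by (simp add: carrier_Rx_iff)
  then have "Poly_Mapping.single p (coeff_tx u p) = 1"
    using u(2) \<open>u \<noteq> 0\<close> by (simp add: lt_def Let_def)
  then have *: "(coeff_tx u p when p = k) = (1 when k = 0)" for k
    by (metis lookup_single lookup_one)
  have "p = 0" using *[of 0] by (auto simp: when_def split: if_splits)
  moreover have "coeff_tx u 0 = 1" using *[of 0] by (auto simp: when_def split: if_splits)
  ultimately show "u \<in> carrier (Rx m n) \<and> is_largest gt (supp u) 0 \<and> coeff_tx u 0 = 1"
    using u(1) p by blast
next
  assume u: "u \<in> carrier (Rx m n) \<and> is_largest gt (supp u) 0 \<and> coeff_tx u 0 = 1"
  then have "u \<noteq> 0" by auto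
  moreover have "largest gt (supp u) = 0"
    using largest_eq[OF gt_total] u by (auto simp: carrier_Rx_iff)
  ultimately show "u \<in> S_gt m n gt" using u by (simp add: S_gt_def lt_def)
qed

lemma one_in_S_gt: "1 \<in> S_gt m n gt"
  by (auto simp: S_gt_iff carrier_Rx_iff supp_def is_largest_def coeff_tx_one zero_in_Mon
      split: if_splits)

lemma vsupp_S_gt_mult_largest:
  assumes "u \<in> S_gt m n gt" "f \<in> carrier (free_module (Rx m n) s)"
    "is_largest gts (vsupp s f) P" "\<And>i. i < s \<Longrightarrow> g i = u * f i"
  shows "is_largest gts (vsupp s g) P \<and>
    coeff_tx (g (snd P)) (fst P) = coeff_tx (f (snd P)) (fst P)"
  by (rule vsupp_mult_largest[OF _ _ _ assms(2,3,4)])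
     (use assms(1) in \<open>auto simp: S_gt_iff carrier_Rx_iff is_largest_def\<close>)

text \<open>
  The rank one case of multiplication by an element of \<open>S\<close>, with \<open>v\<close> as the vector.
\<close>
lemma S_gt_mult:
  assumes u: "u \<in> S_gt m n gt" and v: "v \<in> S_gt m n gt"
  shows "u * v \<in> S_gt m n gt"
proof -
  interpret rank_one: t_local_module_ordering m n 1 "\<lambda>P Q. gt (fst P) (fst Q)" gt
    by (rule rank_one)
  have uv: "u * v \<in> carrier (Rx m n)"
    using u v carrier_Rx_mult by (auto simp: S_gt_iff)
  have "is_largest gt (supp v) 0" "v \<in> carrier (Rx m n)"
    using v by (auto simp: S_gt_iff)
  then have "is_largest (\<lambda>P Q. gt (fst P) (fst Q)) (vsupp 1 (\<lambda>i\<in>{..<1}. u * v)) (0, 0) \<and>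
      coeff_tx (u * v) 0 = coeff_tx v 0"
    using rank_one.vsupp_S_gt_mult_largest[OF u rank_one_carrier[of v],
        where g = "\<lambda>i\<in>{..<1}. u * v" and P = "(0, 0)"]
    by (simp add: rank_one_largest_iff[simplified])
  then show ?thesis
    using uv v by (simp add: S_gt_iff rank_one_largest_iff[simplified])
qed

lemma S_gt_prod: "(\<And>i. i \<in> I \<Longrightarrow> d i \<in> S_gt m n gt) \<Longrightarrow> prod d I \<in> S_gt m n gt"
  by (induction I rule: infinite_finite_induct) (auto intro: S_gt_mult one_in_S_gt)

lemma S_gt_subset_carrier: "u \<in> S_gt m n gt \<Longrightarrow> u \<in> carrier (Rx m n)"
  by (simp add: S_gt_def)

lemma lm_S_gt_mult:
  assumes u: "u \<in> S_gt m n gt" and f: "f \<in> carrier (free_module (Rx m n) s)"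
  shows "lm s gts (\<lambda>i\<in>{..<s}. u * f i) = lm s gts f"
proof (cases "vsupp s f = {}")
  case True
  then have "coeff_tx (f i) p = 0" if "i < s" for i p
    using that by (cases p) (auto simp: vsupp_def)
  then have "coeff_tx (u * f i) p = 0" if "i < s" for i p
    using that by (metis coeff_tx_mult_nonzero)
  then have "vsupp s (\<lambda>i\<in>{..<s}. u * f i) = {}"
    by (auto simp: vsupp_def)
  with True show ?thesis by (simp add: lm_def)
next
  case False
  then obtain P where P: "is_largest gts (vsupp s f) P"
    using vsupp_has_largest[OF f] by blast
  then have "is_largest gts (vsupp s (\<lambda>i\<in>{..<s}. u * f i)) P"
    using vsupp_S_gt_mult_largest[OF u f] by simp
  moreover have "(\<lambda>i\<in>{..<s}. u * f i) \<in> carrier (free_module (Rx m n) s)"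
    using f carrier_Rx_mult[OF S_gt_subset_carrier[OF u]] by (auto simp: free_module_def)
  ultimately show ?thesis using lm_eq[OF _ P] lm_eq f by metis
qed


section \<open>Leading monomials over the localisation\<close>

lemma frac_rel_Rx_iff:
  "((a, u), (b, v)) \<in> frac_rel (Rx m n) (S_gt m n gt) \<longleftrightarrow>
    a \<in> carrier (Rx m n) \<and> u \<in> S_gt m n gt \<and> b \<in> carrier (Rx m n) \<and> v \<in> S_gt m n gt \<and>
    (\<exists>w\<in>S_gt m n gt. w * (v * a) = w * (u * b))"
  by (simp add: frac_rel_def Rx_def)

lemma equiv_frac_rel:
  "equiv (carrier (Rx m n) \<times> S_gt m n gt) (frac_rel (Rx m n) (S_gt m n gt))"
proof (rule equivI)
  show "refl_on (carrier (Rx m n) \<times> S_gt m n gt) (frac_rel (Rx m n) (S_gt m n gt))"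
    using one_in_S_gt by (auto simp: refl_on_def frac_rel_Rx_iff)
  show "frac_rel (Rx m n) (S_gt m n gt) \<subseteq>
      (carrier (Rx m n) \<times> S_gt m n gt) \<times> (carrier (Rx m n) \<times> S_gt m n gt)"
    by (auto simp: frac_rel_def)
  show "sym (frac_rel (Rx m n) (S_gt m n gt))"
    unfolding sym_def by (auto simp: frac_rel_Rx_iff) metis
  show "trans (frac_rel (Rx m n) (S_gt m n gt))"
  proof (rule transI)
    fix x y z
    assume xy: "(x, y) \<in> frac_rel (Rx m n) (S_gt m n gt)"
      and yz: "(y, z) \<in> frac_rel (Rx m n) (S_gt m n gt)"
    obtain a u b v c t where eqs: "x = (a, u)" "y = (b, v)" "z = (c, t)"
      by (metis surj_pair)
    obtain w where w: "w \<in> S_gt m n gt" "w * (v * a) = w * (u * b)"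
      using xy by (auto simp: eqs frac_rel_Rx_iff)
    obtain w' where w': "w' \<in> S_gt m n gt" "w' * (t * b) = w' * (v * c)"
      using yz by (auto simp: eqs frac_rel_Rx_iff)
    \<comment> \<open>The denominator \<open>v\<close> of the middle fraction has to enter the cancelling factor, since the
      equations can only be combined after multiplication by it.\<close>
    have "(w * w' * v) * (t * a) = (w' * t) * (w * (v * a))" by (simp add: ac_simps)
    also have "\<dots> = (w * u) * (w' * (t * b))" by (simp only: w(2)) (simp add: ac_simps)
    also have "\<dots> = (w * w' * v) * (u * c)" by (simp only: w'(2)) (simp add: ac_simps)
    finally have "(w * w' * v) * (t * a) = (w * w' * v) * (u * c)" .
    moreover have "w * w' * v \<in> S_gt m n gt"
      using w(1) w'(1) yz S_gt_mult by (auto simp: eqs frac_rel_Rx_iff)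
    ultimately show "(x, z) \<in> frac_rel (Rx m n) (S_gt m n gt)"
      using xy yz by (auto simp: eqs frac_rel_Rx_iff)
  qed
qed

lemma frac_cancel:
  assumes "a \<in> carrier (Rx m n)" "u \<in> S_gt m n gt" "w \<in> S_gt m n gt"
  shows "frac (Rx m n) (S_gt m n gt) (w * a) (w * u) = frac (Rx m n) (S_gt m n gt) a u"
  unfolding frac_def
proof (rule equiv_class_eq[OF equiv_frac_rel])
  have "1 * (u * (w * a)) = 1 * (w * u * a)" by (simp add: ac_simps)
  then show "((w * a, w * u), (a, u)) \<in> frac_rel (Rx m n) (S_gt m n gt)"
    using assms S_gt_mult carrier_Rx_mult[OF S_gt_subset_carrier[OF assms(3)] assms(1)]
      one_in_S_gt
    by (auto simp: frac_rel_Rx_iff)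
qed

text \<open>
  Numerator \<open>i\<close> is multiplied by the denominators of all other coordinates.
\<close>
lemma common_denominator:
  assumes F: "F \<in> carrier (free_module (Rx_loc m n gt) s)"
  obtains f u where "f \<in> carrier (free_module (Rx m n) s)" "u \<in> S_gt m n gt"
    "F = frac_vec m n s gt f u"
proof -
  have "\<exists>a d. a \<in> carrier (Rx m n) \<and> d \<in> S_gt m n gt \<and> F i = frac (Rx m n) (S_gt m n gt) a d"
    if "i < s" for i
  proof -
    have "F i \<in> (carrier (Rx m n) \<times> S_gt m n gt) // frac_rel (Rx m n) (S_gt m n gt)"
      using F that by (auto simp: free_module_def Rx_loc_def localization_def)
    then show ?thesis by (auto simp: frac_def elim!: quotientE)
  qed
  then obtain a d where ad: "\<And>i. i < s \<Longrightarrow> a i \<in> carrier (Rx m n)"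
    "\<And>i. i < s \<Longrightarrow> d i \<in> S_gt m n gt"
    "\<And>i. i < s \<Longrightarrow> F i = frac (Rx m n) (S_gt m n gt) (a i) (d i)"
    by metis
  define f where "f = (\<lambda>i\<in>{..<s}. prod d ({..<s} - {i}) * a i)"
  have others: "prod d ({..<s} - {i}) \<in> S_gt m n gt" for i
    using ad(2) by (intro S_gt_prod) auto
  show ?thesis
  proof
    show "f \<in> carrier (free_module (Rx m n) s)"
      using carrier_Rx_mult[OF S_gt_subset_carrier[OF others] ad(1)]
      by (auto simp: f_def free_module_def)
    show "prod d {..<s} \<in> S_gt m n gt"
      using ad(2) by (intro S_gt_prod) auto
    show "F = frac_vec m n s gt f (prod d {..<s})"
    proof
      fix i
      show "F i = frac_vec m n s gt f (prod d {..<s}) i"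
      proof (cases "i < s")
        case True
        then have "prod d {..<s} = prod d ({..<s} - {i}) * d i"
          by (simp add: prod.remove[of _ i] mult.commute)
        then show ?thesis
          using True ad frac_cancel[OF ad(1,2) others, of i] by (simp add: frac_vec_def f_def)
      next
        case False
        then show ?thesis
          using F by (simp add: free_module_def frac_vec_def PiE_def extensional_def)
      qed
    qed
  qed
qed

text \<open>
  Equality of fractions gives for each coordinate its own cancelling factor in \<open>S\<close>. Their
  product \<open>W\<close> works for all coordinates at once, so that \<open>W v f = W u g\<close> as vectors, and
  neither side has changed its leading monomial.
\<close>
lemma lm_frac_vec_unique:
  assumes f: "f \<in> carrier (free_module (Rx m n) s)" and u: "u \<in> S_gt m n gt"
    and g: "g \<in> carrier (free_module (Rx m n) s)" and v: "v \<in> S_gt m n gt"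
    and eq: "frac_vec m n s gt f u = frac_vec m n s gt g v"
  shows "lm s gts f = lm s gts g"
proof -
  have "\<exists>w\<in>S_gt m n gt. w * (v * f i) = w * (u * g i)" if i: "i < s" for i
  proof -
    have "frac (Rx m n) (S_gt m n gt) (f i) u = frac (Rx m n) (S_gt m n gt) (g i) v"
      using fun_cong[OF eq, of i] i by (simp add: frac_vec_def)
    moreover have "(g i, v) \<in> carrier (Rx m n) \<times> S_gt m n gt"
      using g v i by (auto simp: free_module_def)
    ultimately have "((f i, u), (g i, v)) \<in> frac_rel (Rx m n) (S_gt m n gt)"
      unfolding frac_def by (rule eq_equiv_class[OF _ equiv_frac_rel])
    then show ?thesis by (simp add: frac_rel_Rx_iff)
  qed
  then obtain w where w: "\<And>i. i < s \<Longrightarrow> w i \<in> S_gt m n gt"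
    "\<And>i. i < s \<Longrightarrow> w i * (v * f i) = w i * (u * g i)"
    by metis
  define W where "W = prod w {..<s}"
  have W: "W \<in> S_gt m n gt" unfolding W_def using w(1) by (intro S_gt_prod) auto
  have eq': "(W * v) * f i = (W * u) * g i" if "i < s" for i
  proof -
    have "W = prod w ({..<s} - {i}) * w i"
      unfolding W_def using that by (simp add: prod.remove[of _ i] mult.commute)
    then show ?thesis using w(2)[OF that] by (simp add: mult.assoc)
  qed
  have "lm s gts f = lm s gts (\<lambda>i\<in>{..<s}. (W * v) * f i)"
    using lm_S_gt_mult[OF S_gt_mult[OF W v] f] by simp
  also have "(\<lambda>i\<in>{..<s}. (W * v) * f i) = (\<lambda>i\<in>{..<s}. (W * u) * g i)"
    using eq' by (intro restrict_ext) auto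
  also have "lm s gts (\<lambda>i\<in>{..<s}. (W * u) * g i) = lm s gts g"
    by (rule lm_S_gt_mult[OF S_gt_mult[OF W u] g])
  finally show ?thesis .
qed

lemma lm_loc_frac_vec:
  assumes "f \<in> carrier (free_module (Rx m n) s)" "u \<in> S_gt m n gt"
  shows "lm_loc m n s gts gt (frac_vec m n s gt f u) = lm s gts f"
  unfolding lm_loc_def
proof (rule the_equality)
  show "\<exists>g v. g \<in> carrier (free_module (Rx m n) s) \<and> v \<in> S_gt m n gt \<and>
      frac_vec m n s gt f u = frac_vec m n s gt g v \<and> lm s gts f = lm s gts g"
    using assms by blast
next
  fix p
  assume "\<exists>g v. g \<in> carrier (free_module (Rx m n) s) \<and> v \<in> S_gt m n gt \<and>
      frac_vec m n s gt f u = frac_vec m n s gt g v \<and> p = lm s gts g"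
  then obtain g v where "g \<in> carrier (free_module (Rx m n) s)" "v \<in> S_gt m n gt"
    "frac_vec m n s gt f u = frac_vec m n s gt g v" "p = lm s gts g"
    by (elim exE conjE)
  then show "p = lm s gts f" using lm_frac_vec_unique[OF assms] by simp
qed

lemma lm_loc_zero_or_monomial:
  assumes "F \<in> carrier (free_module (Rx_loc m n gt) s)"
  shows "lm_loc m n s gts gt F = ((\<lambda>j\<in>{..<s}. 0) :: nat \<Rightarrow> 'a::field Ktx) \<or>
    (\<exists>P\<in>Mons m n s. lm_loc m n s gts gt F = (unit_vec s P :: nat \<Rightarrow> 'a Ktx))"
proof -
  obtain f u where f: "f \<in> carrier (free_module (Rx m n) s)" and u: "u \<in> S_gt m n gt"
    and F: "F = frac_vec m n s gt f u"
    by (rule common_denominator[OF assms])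
  show ?thesis unfolding F lm_loc_frac_vec[OF f u] by (rule lm_zero_or_monomial[OF f])
qed

end

theorem proposition4p2:
  fixes m n s :: nat
    and gts :: "mmon \<Rightarrow> mmon \<Rightarrow> bool"
    and gt :: "mon \<Rightarrow> mon \<Rightarrow> bool"
  assumes "module_monomial_ordering m n s gts"
    and "induced_ordering m n s gts gt"
    and "t_local m gt"
  shows "(\<forall>I :: (nat \<Rightarrow> 'a::field Rx) set.
            submodule I (Rx m n) (free_module (Rx m n) s) \<longrightarrow>
            (\<exists>G. standard_basis m n s (lm s gts) I G)) \<and>
         (\<forall>I :: (nat \<Rightarrow> ('a Rx \<times> 'a Rx) set) set.
            submodule I (Rx_loc m n gt) (free_module (Rx_loc m n gt) s) \<longrightarrow>
            (\<exists>G. standard_basis m n s (lm_loc m n s gts gt) I G))"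
proof (intro conjI allI impI)
  interpret t_local_module_ordering m n s gts gt
    using assms by unfold_locales
  fix I :: "(nat \<Rightarrow> 'a Rx) set"
  assume "submodule I (Rx m n) (free_module (Rx m n) s)"
  then have "I \<subseteq> carrier (free_module (Rx m n) s)"
    by (rule submodule_subset_carrier)
  then show "\<exists>G. standard_basis m n s (lm s gts) I G"
    by (intro standard_basis_exists lm_zero_or_monomial) blast
next
  interpret t_local_module_ordering m n s gts gt
    using assms by unfold_locales
  fix I :: "(nat \<Rightarrow> ('a Rx \<times> 'a Rx) set) set"
  assume "submodule I (Rx_loc m n gt) (free_module (Rx_loc m n gt) s)"
  then have "I \<subseteq> carrier (free_module (Rx_loc m n gt) s)"
    by (rule submodule_subset_carrier)
  then show "\<exists>G. standard_basis m n s (lm_loc m n s gts gt) I G"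
    by (intro standard_basis_exists lm_loc_zero_or_monomial) blast
qed

end
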